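(* For every integer $d\geq 1$, $$\mathcal U_d^{\mathrm{Rational}}=\mathcal U_d^{\mathrm{Real}}=\mathcal A_d .$$ In particular, if $\mathbf y=(y_1,\ldots,y_d)\in\mathbb R^d$ is such that $1,y_1,\ldots,y_d$ are linearly independent over $\mathbb Q$, then for every pair $P,Q\in\mathcal P_d(\mathbb Q)$, $$L_{P+\mathbf y}(t)=L_{Q+\mathbf y}(t)\ \text{ for all } t\in\mathbb Q_{>0}\quad\Longrightarrow\quad P=Q.$$ Conversely, if $1,y_1,\ldots,y_d$ are linearly dependent over $\mathbb Q$, then there exist distinct polytopes $P,Q\in\mathcal P_d(\mathbb Q)$ satisfying $$L_{P+\mathbf y}(t)=L_{Q+\mathbf y}(t)\quad\text{for every real } t>0 .$$
   Context: $\mathcal P_d(\mathbb Q)$ denotes the collection of all full-dimensional rational (convex) polytopes in $\mathbb R^d$, i.e. convex hulls of finitely many points of $\mathbb Q^d$ that have nonempty interior in $\mathbb R^d$. For a bounded polytope $K\subset\mathbb R^d$ (not necessarily rational) and real $t>0$, $L_K(t):=|tK\cap\mathbb Z^d|$; in particular, for $\mathbf y\in\mathbb R^d$, $L_{P+\mathbf y}(t)=|\mathbb Z^d\cap t(P+\mathbf y)|$. Define $$\mathcal U_d^{\mathrm{Real}}:=\{\mathbf y\in\mathbb R^d : \text{for all } P,Q\in\mathcal P_d(\mathbb Q),\ \big(L_{P+\mathbf y}(t)=L_{Q+\mathbf y}(t)\ \text{for all real } t>0\big)\Rightarrow P=Q\},$$ $$\mathcal U_d^{\mathrm{Rational}}:=\{\mathbf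 y\in\mathbb R^d : \text{for all } P,Q\in\mathcal P_d(\mathbb Q),\ \big(L_{P+\mathbf y}(t)=L_{Q+\mathbf y}(t)\ \text{for all } t\in\mathbb Q_{>0}\big)\Rightarrow P=Q\},$$ $$\mathcal A_d:=\{\mathbf y=(y_1,\ldots,y_d)\in\mathbb R^d : 1,y_1,\ldots,y_d \text{ are linearly independent over }\mathbb Q\}.$$ *)

theory Defs
  imports "HOL-Analysis.Analysis"
begin

definition rational_polytopes :: "(real ^ 'n::finite) set set" where
  "rational_polytopes =
     {P. (\<exists>V. finite V \<and> (\<forall>v\<in>V. \<forall>i. v $ i \<in> \<rat>) \<and> P = convex hull V) \<and> interior P \<noteq> {}}"

definition integer_lattice :: "(real ^ 'n::finite) set" where
  "integer_lattice = {x. \<forall>i. x $ i \<in> \<int>}"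

definition lattice_count :: "(real ^ 'n::finite) set \<Rightarrow> real \<Rightarrow> nat" where
  "lattice_count K t = card ((\<lambda>x. t *\<^sub>R x) ` K \<inter> integer_lattice)"

abbreviation translate :: "(real ^ 'n::finite) set \<Rightarrow> real ^ 'n \<Rightarrow> (real ^ 'n) set" where
  "translate P y \<equiv> (\<lambda>x. x + y) ` P"

definition U_real :: "(real ^ 'n::finite) set" where
  "U_real = {y. \<forall>P\<in>rational_polytopes. \<forall>Q\<in>rational_polytopes.
     (\<forall>t>0. lattice_count (translate P y) t = lattice_count (translate Q y) t) \<longrightarrow> P = Q}"

definition U_rational :: "(real ^ 'n::finite) set" where
  "U_rational = {y. \<forall>P\<in>rational_polytopes. \<forall>Q\<in>rational_polytopes.
     (\<forall>t\<in>\<rat>. t > 0 \<longrightarrow> lattice_count (translate P y) t = lattice_count (translate Q y) t) \<longrightarrow> P = Q}"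

text \<open>
  Linear independence over the rationals of the \<^emph>\<open>family\<close> consisting of 1 and the coordinates
  of \<open>y\<close>: a repeated entry makes the family dependent. The library's \<open>independent\<close> is
  about sets; the lemma \<open>rat_independent_with_one_iff\<close> below relates the two.
\<close>

definition rat_independent_with_one :: "real ^ 'n::finite \<Rightarrow> bool" where
  "rat_independent_with_one y \<longleftrightarrow>
     (\<forall>(c0::rat) (c::'n \<Rightarrow> rat).
        of_rat c0 * 1 + (\<Sum>i\<in>UNIV. of_rat (c i) * y $ i) = 0 \<longrightarrow> c0 = 0 \<and> (\<forall>i. c i = 0))"

definition A_set :: "(real ^ 'n::finite) set" where
  "A_set = {y. rat_independent_with_one y}"

text \<open>
  For bounded \<open>K\<close> the cardinality in \<open>lattice_count\<close> is that of a finite set, so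
  the convention that infinite sets have cardinality 0 plays no role.
\<close>

lemma finite_lattice_points:
  fixes K :: "(real ^ 'n::finite) set"
  assumes "bounded K"
  shows "finite ((\<lambda>x. t *\<^sub>R x) ` K \<inter> integer_lattice)"
proof -
  have "bounded ((\<lambda>x. t *\<^sub>R x) ` K)"
    using assms by (rule bounded_scaling)
  then obtain B where B: "\<And>x. x \<in> (\<lambda>x. t *\<^sub>R x) ` K \<Longrightarrow> norm x \<le> B"
    unfolding bounded_iff by blast
  have fin: "finite {k \<in> \<int>. \<bar>k\<bar> \<le> B}"
    by (rule finite_abs_int_segment)
  have "finite {f. \<forall>i::'n. (i \<in> UNIV \<longrightarrow> f i \<in> {k::real \<in> \<int>. \<bar>k\<bar> \<le> B}) \<and> (i \<notin> UNIV \<longrightarrow> f i = 0)}"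
    using fin by (intro finite_set_of_finite_funs) simp_all
  then have "finite (vec_lambda ` {f. \<forall>i::'n. f i \<in> {k::real \<in> \<int>. \<bar>k\<bar> \<le> B}})"
    by (intro finite_imageI) simp
  moreover have "(\<lambda>x. t *\<^sub>R x) ` K \<inter> integer_lattice
      \<subseteq> vec_lambda ` {f. \<forall>i::'n. f i \<in> {k::real \<in> \<int>. \<bar>k\<bar> \<le> B}}"
  proof
    fix x assume x: "x \<in> (\<lambda>x. t *\<^sub>R x) ` K \<inter> integer_lattice"
    then have "norm x \<le> B" using B by blast
    then have "\<bar>x $ i\<bar> \<le> B" for i
      using component_le_norm_cart[of x i] by linarith
    with x show "x \<in> vec_lambda ` {f. \<forall>i::'n. f i \<in> {k::real \<in> \<int>. \<bar>k\<bar> \<le> B}}"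
      by (intro image_eqI[of _ _ "vec_nth x"]) (auto simp: integer_lattice_def)
  qed
  ultimately show ?thesis by (rule finite_subset[rotated])
qed

lemma rat_independent_with_one_iff:
  fixes y :: "real ^ 'n::finite"
  defines "f \<equiv> case_option 1 (\<lambda>i. y $ i)"
  shows "rat_independent_with_one y \<longleftrightarrow>
    inj f \<and> \<not> module.dependent (\<lambda>(r::rat) (x::real). of_rat r * x) (range f)"
proof -
  interpret M: vector_space "\<lambda>(r::rat) (x::real). of_rat r * x"
    by unfold_locales (auto simp: algebra_simps of_rat_add of_rat_mult)
  have sum_opt: "(\<Sum>o'\<in>UNIV. of_rat (u o') * f o') = of_rat (u None) * 1 + (\<Sum>i\<in>UNIV. of_rat (u (Some i)) * y $ i)"
    for u :: "'n option \<Rightarrow> rat"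
    by (simp add: UNIV_option_conv f_def sum.reindex)
  have fam: "rat_independent_with_one y \<longleftrightarrow>
     (\<forall>u :: 'n option \<Rightarrow> rat. (\<Sum>o'\<in>UNIV. of_rat (u o') * f o') = 0 \<longrightarrow> (\<forall>o'. u o' = 0))"
    (is "_ = ?F")
  proof
    assume "rat_independent_with_one y"
    then show ?F
      unfolding sum_opt rat_independent_with_one_def by (metis not_None_eq)
  next
    assume F: ?F
    show "rat_independent_with_one y"
      unfolding rat_independent_with_one_def
    proof (intro allI impI)
      fix c0 :: rat and c :: "'n \<Rightarrow> rat"
      assume "of_rat c0 * 1 + (\<Sum>i\<in>UNIV. of_rat (c i) * y $ i) = 0"
      then have "\<forall>o'. case_option c0 c o' = 0"
        using F[rule_format, of "case_option c0 c"] unfolding sum_opt by simp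
      then show "c0 = 0 \<and> (\<forall>i. c i = 0)"
        by (metis option.case)
    qed
  qed
  show ?thesis
  proof
    assume "rat_independent_with_one y"
    then have F: "\<And>u o'. (\<Sum>o'\<in>UNIV. of_rat (u o') * f o') = 0 \<Longrightarrow> u o' = 0"
      using fam by blast
    have inj: "inj f"
    proof (rule injI, rule ccontr)
      fix a b assume ab: "f a = f b" "a \<noteq> b"
      have "(\<Sum>o'\<in>UNIV. of_rat ((if o' = a then 1 else 0) - (if o' = b then 1 else 0)) * f o')
          = (\<Sum>o'\<in>UNIV. (if o' = a then f o' else 0)) - (\<Sum>o'\<in>UNIV. (if o' = b then f o' else 0))"
        by (subst sum_subtractf[symmetric], rule sum.cong)
           (auto simp: of_rat_diff of_rat_minus left_diff_distrib)
      also have "\<dots> = 0" using ab by simp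
      finally show False
        using F[of "\<lambda>o'. (if o' = a then 1 else 0) - (if o' = b then 1 else 0)" a] ab by simp
    qed
    moreover have "\<not> M.dependent (range f)"
    proof
      assume "M.dependent (range f)"
      then obtain u where u: "\<exists>v\<in>range f. u v \<noteq> 0" "(\<Sum>v\<in>range f. of_rat (u v) * v) = 0"
        by (auto simp: M.dependent_finite)
      from u(2) have "(\<Sum>o'\<in>UNIV. of_rat (u (f o')) * f o') = 0"
        using inj by (simp add: sum.reindex)
      then show False using F[of "\<lambda>o'. u (f o')"] u(1) by auto
    qed
    ultimately show "inj f \<and> \<not> M.dependent (range f)" ..
  next
    assume asm: "inj f \<and> \<not> M.dependent (range f)"
    show "rat_independent_with_one y"
      unfolding fam
    proof (intro allI impI)
      fix u o'
      assume s: "(\<Sum>o'\<in>UNIV. of_rat (u o') * f o') = 0"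
      have z: "(\<Sum>v\<in>range f. of_rat (u (inv f v)) * v) = 0"
        using asm s by (simp add: sum.reindex)
      have w: "\<And>w. (\<Sum>v\<in>range f. of_rat (w v) * v) = 0 \<Longrightarrow> \<forall>v\<in>range f. w v = 0"
        using asm M.dependent_finite[of "range f"] by (meson finite finite_imageI)
      have "\<forall>v\<in>range f. u (inv f v) = 0"
        using w[of "\<lambda>v. u (inv f v)", OF z] .
      then show "u o' = 0" using asm by simp
    qed
  qed
qed

end

(* A facet inequality a.x <= b of P becomes a.z <= t (b + a.y) for the lattice points z of
   t (P + y). If 1, y_1, ..., y_d are independent over the rationals, two such constraints can be
   tight at lattice points for the same t only if (a, b) and (a', b') are proportional, so the
   count jumps at such a t, with the sign of b + a.y, and the jump is caused by one facet only.
   The counts at rational t determine both one-sided limits at every real t, hence the jumps,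
   hence the facet halfspaces of P. Conversely, if a.y is rational for some integer vector
   a /= 0, a rational translation reduces to a.y = 0, and then a nontrivial unimodular map
   x + (a.x) v fixes y and maps P to a different polytope with the same counts. *)

theory Submission
  imports Defs
begin

section \<open>Rational facet descriptions of rational polytopes\<close>

text \<open>The set \<open>{1}\<close> is independent over the rationals, so sending
  \<open>1\<close> to \<open>1\<close> extends to a rational-linear functional on the reals. Applied
  to the coefficients of a real linear equation, it yields a rational equation that keeps all
  rational solutions of the original one.\<close>

lemma rat_linear_retraction:
  obtains \<phi> :: "real \<Rightarrow> real"
  where "range \<phi> \<subseteq> \<rat>" "\<And>x y. \<phi> (x + y) = \<phi> x + \<phi> y"
    "\<And>r x. r \<in> \<rat> \<Longrightarrow> \<phi> (r * x) = r * \<phi> x" "\<phi> 1 = 1"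
proof -
  interpret vector_space_pair "\<lambda>(r::rat) (x::real). of_rat r * x" "(*) :: rat \<Rightarrow> rat \<Rightarrow> rat"
    by unfold_locales (auto simp: algebra_simps of_rat_add of_rat_mult)
  obtain g where g: "Vector_Spaces.linear (\<lambda>(r::rat) (x::real). of_rat r * x) (*) g" "g 1 = 1"
    using linear_independent_extend[of "{1}" "\<lambda>_. 1"] by auto
  interpret g: Vector_Spaces.linear "\<lambda>(r::rat) (x::real). of_rat r * x" "(*)" g by (fact g(1))
  show ?thesis
  proof
    show "range (\<lambda>x. of_rat (g x) :: real) \<subseteq> \<rat>" by auto
    show "real_of_rat (g (r * x)) = r * of_rat (g x)" if "r \<in> \<rat>" for r x
      using that by (auto elim!: Rats_cases simp: g.scale of_rat_mult)
  qed (simp_all add: g.add g(2) of_rat_add)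
qed

text \<open>The points of \<open>S\<close> span the hyperplane, so its equation is unique up to a
  factor. Once one coefficient is normalized to a rational value, the retraction has to reproduce
  the whole equation, which is therefore rational.\<close>

lemma rational_hyperplane:
  fixes a :: "real ^ 'n::finite"
  assumes S: "\<And>v. v \<in> S \<Longrightarrow> a \<bullet> v = b" "\<And>v i. v \<in> S \<Longrightarrow> v $ i \<in> \<rat>"
    and "a \<noteq> 0" "\<epsilon> > 0" and x0: "a \<bullet> x0 = b"
    and sub: "\<And>x. a \<bullet> x = b \<Longrightarrow> dist x0 x < \<epsilon> \<Longrightarrow> x \<in> convex hull S"
  obtains c where "c > 0" "\<And>i. c * a $ i \<in> \<rat>" "c * b \<in> \<rat>"
proof -
  obtain i where i: "a $ i \<noteq> 0" using \<open>a \<noteq> 0\<close> by (auto simp: vec_eq_iff)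
  \<comment> \<open>Entry \<open>i\<close> of the scaled normal becomes 1 or -1, which \<phi> fixes.
    The absolute value keeps \<open>c\<close> positive, so that scaling does not reverse the facet
    inequality.\<close>
  define c where "c = 1 / \<bar>a $ i\<bar>"
  have c: "c > 0" using i by (simp add: c_def)
  obtain \<phi> :: "real \<Rightarrow> real" where \<phi>: "range \<phi> \<subseteq> \<rat>" "\<And>x y. \<phi> (x + y) = \<phi> x + \<phi> y"
    "\<And>r x. r \<in> \<rat> \<Longrightarrow> \<phi> (r * x) = r * \<phi> x" "\<phi> 1 = 1"
    using rat_linear_retraction by metis
  have \<phi>0: "\<phi> 0 = 0" using \<phi>(3)[of 0 0] by simp
  have \<phi>sum: "\<phi> (sum f A) = (\<Sum>x\<in>A. \<phi> (f x))" if "finite A" for f and A :: "'n set"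
    using that by induction (auto simp: \<phi>0 \<phi>(2))
  txt \<open>As \<open>\<phi>\<close> is linear over the rationals, \<open>u\<close> is again a normal of the hyperplane
    spanned by \<open>S\<close>, hence a multiple of \<open>a\<close>; entry \<open>i\<close> identifies it as \<open>c *\<^sub>R a\<close>.\<close>
  define u where "u = (\<chi> j. \<phi> (c * a $ j))"
  have uv: "u \<bullet> v = \<phi> (c * b)" if "v \<in> S" for v
  proof -
    have "u \<bullet> v = (\<Sum>j\<in>UNIV. \<phi> (v $ j * (c * a $ j)))"
      using S(2)[OF that] by (simp add: u_def inner_vec_def \<phi>(3) mult.commute)
    also have "\<dots> = \<phi> (c * (\<Sum>j\<in>UNIV. a $ j * v $ j))"
      by (simp add: \<phi>sum[symmetric] sum_distrib_left mult_ac)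
    also have "(\<Sum>j\<in>UNIV. a $ j * v $ j) = b"
      using S(1)[OF that] by (simp add: inner_vec_def)
    finally show ?thesis .
  qed
  have hull: "convex hull S \<subseteq> {x. u \<bullet> x = \<phi> (c * b)}"
    by (rule hull_minimal) (auto simp: uv convex_hyperplane)
  \<comment> \<open>A small step from \<open>x0\<close> along the hyperplane stays in the hull,
    where \<open>u\<close> is constant; hence \<open>u\<close> vanishes on the orthogonal complement
    of \<open>a\<close>.\<close>
  have *: "u \<bullet> w = 0" if "a \<bullet> w = 0" for w
  proof (cases "w = 0")
    case False
    define \<delta> where "\<delta> = \<epsilon> / (2 * norm w)"
    have \<delta>: "\<delta> > 0" using False \<open>\<epsilon> > 0\<close> by (simp add: \<delta>_def)
    have "dist x0 (x0 + \<delta> *\<^sub>R w) = \<epsilon> / 2"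
      using False \<delta> \<open>\<epsilon> > 0\<close> by (simp add: dist_norm \<delta>_def)
    then have "x0 + \<delta> *\<^sub>R w \<in> convex hull S"
      using \<open>\<epsilon> > 0\<close> that x0 by (intro sub) (auto simp: inner_simps)
    moreover have "x0 \<in> convex hull S"
      using \<open>\<epsilon> > 0\<close> x0 by (intro sub) auto
    ultimately have "u \<bullet> (x0 + \<delta> *\<^sub>R w) = u \<bullet> x0"
      using hull by (metis (mono_tags, lifting) mem_Collect_eq subsetD)
    then show ?thesis using \<delta> by (simp add: inner_simps)
  qed simp
  \<comment> \<open>This is the coefficient of the projection of \<open>u\<close> to
    \<open>a\<close>. The remainder is orthogonal to \<open>a\<close>, hence by \<open>*\<close> to
    \<open>u\<close>, hence to itself.\<close>
  define \<mu> where "\<mu> = u \<bullet> a / (a \<bullet> a)"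
  have aa: "a \<bullet> a \<noteq> 0" using \<open>a \<noteq> 0\<close> by simp
  have aw: "a \<bullet> (u - \<mu> *\<^sub>R a) = 0"
    using aa by (simp add: inner_simps \<mu>_def inner_commute)
  then have "(u - \<mu> *\<^sub>R a) \<bullet> (u - \<mu> *\<^sub>R a) = 0"
    using *[OF aw] by (simp add: inner_diff_left)
  then have u: "u = \<mu> *\<^sub>R a" by simp
  have sgn: "c * a $ i \<in> \<rat>"
    using i by (cases "a $ i > 0") (auto simp: c_def)
  have "u $ i = c * a $ i"
    using \<phi>(3)[OF sgn, of 1] \<phi>(4) by (simp add: u_def)
  then have "\<mu> = c" using i by (simp add: u)
  then have "c * a $ j = \<phi> (c * a $ j)" for j
    using u by (simp add: u_def vec_eq_iff)
  then have rat: "c * a $ j \<in> \<rat>" for j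
    using \<phi>(1) by (metis range_subsetD)
  moreover have "c * b \<in> \<rat>"
  proof -
    have "x0 \<in> convex hull S" using \<open>\<epsilon> > 0\<close> x0 by (intro sub) auto
    then have "u \<bullet> x0 = \<phi> (c * b)" using hull by blast
    then have "c * b = \<phi> (c * b)" using x0 \<open>\<mu> = c\<close> by (simp add: u)
    then show ?thesis using \<phi>(1) by (metis range_subsetD)
  qed
  ultimately show ?thesis using that c by blast
qed

text \<open>A minimal halfspace description has one halfspace per facet. Near a relative interior
  point of a facet, the hyperplane stays inside \<open>P\<close>, and the facet is the hull of some
  of the rational generators, so \<open>rational_hyperplane\<close> applies. The last conclusion
  records a point where one constraint alone is tight; it later makes the facet visible to the
  lattice.\<close>

lemma rational_polytope_halfspaces:
  fixes P :: "(real ^ 'n::finite) set"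
  assumes "P \<in> rational_polytopes"
  obtains H :: "((real ^ 'n) \<times> real) set" where "finite H"
    "P = {x. \<forall>(a, b)\<in>H. a \<bullet> x \<le> b}"
    "\<And>a b. (a, b) \<in> H \<Longrightarrow> a \<noteq> 0 \<and> (\<forall>i. a $ i \<in> \<rat>) \<and> b \<in> \<rat>"
    "\<And>a b. (a, b) \<in> H \<Longrightarrow> \<exists>x. a \<bullet> x = b \<and> (\<forall>(a', b')\<in>H - {(a, b)}. a' \<bullet> x < b')"
proof -
  obtain V where V: "finite V" "\<And>v i. v \<in> V \<Longrightarrow> v $ i \<in> \<rat>" and P: "P = convex hull V"
    and int: "interior P \<noteq> {}"
    using assms unfolding rational_polytopes_def by blast
  have aff: "affine hull P = UNIV" using int by (rule affine_hull_nonempty_interior)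
  have "polyhedron P"
    using V(1) P polytope_def polytope_imp_polyhedron by blast
  then have "\<exists>F. finite F \<and> P = \<Inter>F \<and> (\<forall>h\<in>F. \<exists>a b. a \<noteq> 0 \<and> h = {x. a \<bullet> x \<le> b})
      \<and> (\<forall>F'. F' \<subset> F \<longrightarrow> P \<subset> \<Inter>F')"
    unfolding polyhedron_Int_affine_minimal aff Int_UNIV_left .
  then obtain F where F: "finite F" "P = \<Inter>F" "\<forall>h\<in>F. \<exists>a b. a \<noteq> 0 \<and> h = {x. a \<bullet> x \<le> b}"
    "\<forall>F'. F' \<subset> F \<longrightarrow> P \<subset> \<Inter>F'"
    by (elim exE conjE)
  from F(3) obtain a b where "\<forall>h\<in>F. a h \<noteq> 0 \<and> h = {x. a h \<bullet> x \<le> b h}"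
    by metis
  then have a0: "\<And>h. h \<in> F \<Longrightarrow> a h \<noteq> 0"
    and ab: "\<And>h x. h \<in> F \<Longrightarrow> x \<in> h \<longleftrightarrow> a h \<bullet> x \<le> b h"
    by blast+
  obtain p where p: "p \<in> interior P" using int by blast
  have pF: "a h \<bullet> p < b h" if "h \<in> F" for h
  proof -
    have "P \<subseteq> {x. a h \<bullet> x \<le> b h}" using F(2) ab that by blast
    then have "p \<in> interior {x. a h \<bullet> x \<le> b h}" using p interior_mono by blast
    moreover have "interior {x. a h \<bullet> x \<le> b h} = {x. a h \<bullet> x < b h}"
      using a0[OF that] by (rule interior_halfspace_le)
    ultimately show ?thesis by blast
  qed
  have facet: "\<exists>x. a h \<bullet> x = b h \<and> (\<forall>k\<in>F - {h}. a k \<bullet> x < b k)" if h: "h \<in> F" for h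
  proof -
    have "P \<subset> \<Inter>(F - {h})" using h by (intro F(4)[rule_format]) auto
    then obtain x1 where x1: "x1 \<notin> P" "x1 \<in> \<Inter>(F - {h})" by blast
    have k1: "a k \<bullet> x1 \<le> b k" if "k \<in> F - {h}" for k
      using x1(2) ab that by blast
    have h1: "a h \<bullet> x1 > b h"
    proof -
      have "x1 \<notin> h" using x1 F(2) h by blast
      then show ?thesis using ab[OF h] by (simp add: not_le)
    qed
    \<comment> \<open>By minimality \<open>x1\<close> violates only \<open>h\<close>. The segment
      from the interior point \<open>p\<close> to \<open>x1\<close> meets the boundary of
      \<open>h\<close> at parameter \<open>s < 1\<close>, where the other constraints are still
      strict.\<close>
    define s where "s = (b h - a h \<bullet> p) / (a h \<bullet> x1 - a h \<bullet> p)"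
    have s: "0 < s" "s < 1" "s * (a h \<bullet> x1 - a h \<bullet> p) = b h - a h \<bullet> p"
      using pF[OF h] h1 by (auto simp: s_def)
    define x where "x = (1 - s) *\<^sub>R p + s *\<^sub>R x1"
    have "a h \<bullet> x = b h" using s(3) by (simp add: x_def inner_simps algebra_simps)
    moreover have "a k \<bullet> x < b k" if "k \<in> F - {h}" for k
    proof -
      have "(1 - s) * (a k \<bullet> p) < (1 - s) * b k" using pF[of k] that s by simp
      moreover have "s * (a k \<bullet> x1) \<le> s * b k" using k1[OF that] s by simp
      ultimately show ?thesis by (simp add: x_def inner_simps algebra_simps)
    qed
    ultimately show ?thesis by blast
  qed
  have "\<exists>c>0. (\<forall>i. c * a h $ i \<in> \<rat>) \<and> c * b h \<in> \<rat>" if h: "h \<in> F" for h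
  proof -
    obtain x0 where x0: "a h \<bullet> x0 = b h" "\<forall>k\<in>F - {h}. a k \<bullet> x0 < b k"
      using facet[OF h] by blast
    have "open (\<Inter>k\<in>F - {h}. {x. a k \<bullet> x < b k})"
      using F(1) by (intro open_INT) (auto simp: open_halfspace_lt)
    moreover have "x0 \<in> (\<Inter>k\<in>F - {h}. {x. a k \<bullet> x < b k})" using x0 by blast
    ultimately obtain \<epsilon> where \<epsilon>: "\<epsilon> > 0" "ball x0 \<epsilon> \<subseteq> (\<Inter>k\<in>F - {h}. {x. a k \<bullet> x < b k})"
      by (rule openE)
    have inP: "x \<in> P" if "a h \<bullet> x = b h" "dist x0 x < \<epsilon>" for x
    proof -
      have "x \<in> k" if k: "k \<in> F" for k
      proof -
        have "x \<in> ball x0 \<epsilon>" using \<open>dist x0 x < \<epsilon>\<close> by simp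
        then have "a k \<bullet> x < b k" if "k \<noteq> h"
          using \<epsilon>(2) k that by blast
        then have "a k \<bullet> x \<le> b k"
          using \<open>a h \<bullet> x = b h\<close> by (cases "k = h") (simp, simp add: less_imp_le)
        then show ?thesis using ab[OF k] by blast
      qed
      then show ?thesis using F(2) by blast
    qed
    have "P \<inter> {x. a h \<bullet> x = b h} face_of P"
    proof (rule face_of_Int_supporting_hyperplane_le)
      show "convex P" by (simp add: P)
      show "a h \<bullet> x \<le> b h" if "x \<in> P" for x using that F(2) h ab[OF h] by blast
    qed
    then obtain S where S: "S \<subseteq> V" "P \<inter> {x. a h \<bullet> x = b h} = convex hull S"
      using face_of_convex_hull_subset[OF finite_imp_compact[OF V(1)]] P by metis
    obtain c where "c > 0" "\<And>i. c * a h $ i \<in> \<rat>" "c * b h \<in> \<rat>"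
    proof (rule rational_hyperplane[of S "a h" "b h" \<epsilon> x0])
      show "a h \<bullet> v = b h" if "v \<in> S" for v
        using that S(2) hull_subset[of S convex] by blast
      show "v $ i \<in> \<rat>" if "v \<in> S" for v i using that S(1) V(2) by blast
      show "x \<in> convex hull S" if "a h \<bullet> x = b h" "dist x0 x < \<epsilon>" for x
        using inP[OF that] that(1) S(2) by blast
    qed (use a0[OF h] \<epsilon>(1) x0(1) in auto)
    then show ?thesis by blast
  qed
  then obtain c where c: "\<And>h. h \<in> F \<Longrightarrow> c h > 0 \<and> (\<forall>i. c h * a h $ i \<in> \<rat>) \<and> c h * b h \<in> \<rat>"
    by metis
  let ?g = "\<lambda>h. (c h *\<^sub>R a h, c h * b h)"
  show ?thesis
  proof
    show "finite (?g ` F)" using F(1) by simp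
    show "P = {x. \<forall>(a, b)\<in>?g ` F. a \<bullet> x \<le> b}"
    proof -
      have "x \<in> h \<longleftrightarrow> (c h *\<^sub>R a h) \<bullet> x \<le> c h * b h" if "h \<in> F" for h x
        using ab[OF that] c[OF that] by simp
      then have "x \<in> P \<longleftrightarrow> (\<forall>h\<in>F. (c h *\<^sub>R a h) \<bullet> x \<le> c h * b h)" for x
        by (simp add: F(2))
      then show ?thesis by blast
    qed
    show "a' \<noteq> 0 \<and> (\<forall>i. a' $ i \<in> \<rat>) \<and> b' \<in> \<rat>" if a'b': "(a', b') \<in> ?g ` F" for a' b'
    proof -
      obtain h where h: "h \<in> F" "a' = c h *\<^sub>R a h" "b' = c h * b h" using a'b' by blast
      show ?thesis using a0[OF h(1)] c[OF h(1)] h(2,3) by simp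
    qed
    show "\<exists>x. a' \<bullet> x = b' \<and> (\<forall>(a'', b'')\<in>?g ` F - {(a', b')}. a'' \<bullet> x < b'')"
      if a'b': "(a', b') \<in> ?g ` F" for a' b'
    proof -
      obtain h where h: "h \<in> F" "a' = c h *\<^sub>R a h" "b' = c h * b h" using a'b' by blast
      obtain x where x: "a h \<bullet> x = b h" "\<forall>k\<in>F - {h}. a k \<bullet> x < b k" using facet[OF h(1)] by blast
      have "a' \<bullet> x = b'" using x(1) h(2,3) by simp
      moreover have "(c k *\<^sub>R a k) \<bullet> x < c k * b k" if "k \<in> F" "?g k \<noteq> (a', b')" for k
      proof -
        have "a k \<bullet> x < b k" using x(2) h that by blast
        then show ?thesis using c[OF that(1)] by simp
      qed
      ultimately show ?thesis by blast
    qed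
  qed
qed

section \<open>One-sided limits of the lattice point count\<close>

text \<open>
  The lattice points of \<open>s (P + y)\<close>, with \<open>P\<close> cut out by \<open>H\<close>, for all \<open>s\<close> close to \<open>t\<close> on the
  side given by the sign of \<open>\<sigma>\<close> (right for \<open>\<sigma> > 0\<close>).
\<close>

definition tight_or_strict :: "real \<Rightarrow> ((real ^ 'n::finite) \<times> real) set \<Rightarrow> real ^ 'n \<Rightarrow> real \<Rightarrow> (real ^ 'n) set" where
  "tight_or_strict \<sigma> H y t = {z \<in> integer_lattice. \<forall>(a, b)\<in>H. a \<bullet> z < t * (b + a \<bullet> y)
      \<or> a \<bullet> z = t * (b + a \<bullet> y) \<and> \<sigma> * (b + a \<bullet> y) > 0}"

lemma mem_dilate_translate_iff:
  fixes y z :: "real ^ 'n::finite"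
  assumes "t > 0"
  shows "z \<in> (\<lambda>x. t *\<^sub>R x) ` translate {x. \<forall>(a, b)\<in>H. a \<bullet> x \<le> b} y
    \<longleftrightarrow> (\<forall>(a, b)\<in>H. a \<bullet> z \<le> t * (b + a \<bullet> y))"
proof -
  have "z \<in> (\<lambda>x. t *\<^sub>R x) ` translate X y \<longleftrightarrow> z /\<^sub>R t - y \<in> X" for X
  proof
    assume "z \<in> (\<lambda>x. t *\<^sub>R x) ` translate X y"
    then show "z /\<^sub>R t - y \<in> X" using assms by auto
  next
    assume "z /\<^sub>R t - y \<in> X"
    then show "z \<in> (\<lambda>x. t *\<^sub>R x) ` translate X y"
      using assms by (intro image_eqI[of _ _ "z /\<^sub>R t"] image_eqI[of _ _ "z /\<^sub>R t - y"]) auto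
  qed
  moreover have "a \<bullet> (z /\<^sub>R t - y) \<le> b \<longleftrightarrow> a \<bullet> z \<le> t * (b + a \<bullet> y)" for a b
    using assms by (simp add: inner_simps field_simps)
  ultimately show ?thesis by (simp add: case_prod_unfold)
qed

lemma finite_tight_or_strict:
  fixes H :: "((real ^ 'n::finite) \<times> real) set"
  assumes bdd: "bounded {x. \<forall>(a, b)\<in>H. a \<bullet> x \<le> b}" and t: "t > 0"
  shows "finite (tight_or_strict \<sigma> H y t)"
proof (rule finite_subset)
  let ?P = "{x. \<forall>(a, b)\<in>H. a \<bullet> x \<le> b}"
  show "tight_or_strict \<sigma> H y t \<subseteq> (\<lambda>x. t *\<^sub>R x) ` translate ?P y \<inter> integer_lattice"
  proof
    fix z assume "z \<in> tight_or_strict \<sigma> H y t"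
    then have "z \<in> integer_lattice" "\<forall>(a, b)\<in>H. a \<bullet> z \<le> t * (b + a \<bullet> y)"
      by (auto simp: tight_or_strict_def)
    then show "z \<in> (\<lambda>x. t *\<^sub>R x) ` translate ?P y \<inter> integer_lattice"
      using mem_dilate_translate_iff[OF t] by blast
  qed
  have "bounded (translate ?P y)"
    using bounded_translation[OF bdd, of y] by (simp add: add.commute)
  then show "finite ((\<lambda>x. t *\<^sub>R x) ` translate ?P y \<inter> integer_lattice)"
    by (rule finite_lattice_points)
qed

text \<open>For dilations below \<open>2 * t0\<close> only finitely many lattice points compete. For
  each of them a strict or violated constraint at \<open>t0\<close> stays so nearby, and a tight one
  is decided by whether its right-hand side grows or shrinks on the chosen side.\<close>

lemma eventually_lattice_count:
  fixes H :: "((real ^ 'n::finite) \<times> real) set"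
  assumes fin: "finite H" and bdd: "bounded {x. \<forall>(a, b)\<in>H. a \<bullet> x \<le> b}"
    and ne: "\<And>a b. (a, b) \<in> H \<Longrightarrow> b + a \<bullet> y \<noteq> 0"
    and t0: "t0 > 0" and \<sigma>: "\<sigma> \<noteq> 0"
  shows "\<forall>\<^sub>F t in at t0 within {t. \<sigma> * (t - t0) > 0}.
    lattice_count (translate {x. \<forall>(a, b)\<in>H. a \<bullet> x \<le> b} y) t = card (tight_or_strict \<sigma> H y t0)"
proof -
  let ?P = "{x. \<forall>(a, b)\<in>H. a \<bullet> x \<le> b}" and ?F = "at t0 within {t. \<sigma> * (t - t0) > 0}"
  obtain B where B: "\<And>x. x \<in> ?P \<Longrightarrow> norm x \<le> B" using bdd unfolding bounded_iff by blast
  \<comment> \<open>The radius bounds all dilates with factor below \<open>2 * t0\<close>, so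
    \<open>W\<close> does not depend on \<open>t\<close> and finitely many eventual statements can
    be combined.\<close>
  define W where "W = cball (0 :: real ^ 'n) (2 * t0 * (\<bar>B\<bar> + norm y)) \<inter> integer_lattice"
  have finW: "finite W"
    using finite_lattice_points[OF bounded_cball, of 1] by (simp add: W_def)
  have inW: "z \<in> W" if t: "0 < t" "t < 2 * t0"
    and z: "z \<in> integer_lattice" "\<forall>(a, b)\<in>H. a \<bullet> z \<le> t * (b + a \<bullet> y)" for z t
  proof -
    have "z \<in> (\<lambda>x. t *\<^sub>R x) ` translate ?P y" using mem_dilate_translate_iff[OF t(1)] z(2) by blast
    then obtain x where x: "x \<in> ?P" "z = t *\<^sub>R (x + y)" by blast
    have "norm (x + y) \<le> \<bar>B\<bar> + norm y"
      using B[OF x(1)] norm_triangle_ineq[of x y] by linarith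
    then have "t * norm (x + y) \<le> 2 * t0 * (\<bar>B\<bar> + norm y)"
      using t by (intro mult_mono) auto
    then show ?thesis using t z(1) x(2) by (simp add: W_def)
  qed
  have near: "\<forall>\<^sub>F t in ?F. 0 < t \<and> t < 2 * t0"
  proof -
    have "\<forall>\<^sub>F t in ?F. dist t t0 < t0" using t0 by (auto simp: eventually_at)
    then show ?thesis by eventually_elim (auto simp: dist_real_def)
  qed
  have one: "\<forall>\<^sub>F t in ?F. a \<bullet> z \<le> t * (b + a \<bullet> y) \<longleftrightarrow>
      a \<bullet> z < t0 * (b + a \<bullet> y) \<or> a \<bullet> z = t0 * (b + a \<bullet> y) \<and> \<sigma> * (b + a \<bullet> y) > 0"
    if "(a, b) \<in> H" for a b z
  proof -
    define \<beta> where "\<beta> = b + a \<bullet> y"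
    have \<beta>: "\<beta> \<noteq> 0" using ne[OF that] by (simp add: \<beta>_def)
    have lim: "((\<lambda>t. t * \<beta>) \<longlongrightarrow> t0 * \<beta>) ?F" by (intro tendsto_intros)
    have "\<forall>\<^sub>F t in ?F. a \<bullet> z \<le> t * \<beta> \<longleftrightarrow> a \<bullet> z < t0 * \<beta> \<or> a \<bullet> z = t0 * \<beta> \<and> \<sigma> * \<beta> > 0"
    proof (cases "a \<bullet> z" "t0 * \<beta>" rule: linorder_cases)
      case less
      show ?thesis using order_tendstoD(1)[OF lim less] by eventually_elim (use less in auto)
    next
      case greater
      show ?thesis using order_tendstoD(2)[OF lim greater] by eventually_elim (use greater in auto)
    next
      case equal
      have "\<forall>\<^sub>F t in ?F. \<sigma> * (t - t0) > 0" by (auto simp: eventually_at intro!: exI[of _ 1])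
      then show ?thesis
      proof eventually_elim
        case (elim t)
        \<comment> \<open>On the chosen side \<open>t - t0\<close> has the sign of \<sigma>, so the
          sign of \<open>(t - t0) * \<beta>\<close> is that of
          \<open>\<sigma> * \<beta>\<close>.\<close>
        have "a \<bullet> z \<le> t * \<beta> \<longleftrightarrow> (t - t0) * \<beta> \<ge> 0" using equal by (simp add: algebra_simps)
        also have "\<dots> \<longleftrightarrow> \<sigma> * \<beta> > 0"
          using elim \<beta> by (auto simp: zero_less_mult_iff zero_le_mult_iff)
        finally show ?case using equal by simp
      qed
    qed
    then show ?thesis by (simp add: \<beta>_def)
  qed
  have "\<forall>\<^sub>F t in ?F. \<forall>z\<in>W. \<forall>(a, b)\<in>H. a \<bullet> z \<le> t * (b + a \<bullet> y) \<longleftrightarrow>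
      a \<bullet> z < t0 * (b + a \<bullet> y) \<or> a \<bullet> z = t0 * (b + a \<bullet> y) \<and> \<sigma> * (b + a \<bullet> y) > 0"
    using one by (intro eventually_ball_finite ballI finW fin) auto
  with near show ?thesis
  proof eventually_elim
    case (elim t)
    have "(\<lambda>x. t *\<^sub>R x) ` translate ?P y \<inter> integer_lattice = tight_or_strict \<sigma> H y t0"
    proof (intro set_eqI)
      fix z
      have "z \<in> (\<lambda>x. t *\<^sub>R x) ` translate ?P y \<inter> integer_lattice \<longleftrightarrow>
          z \<in> W \<and> z \<in> integer_lattice \<and> (\<forall>(a, b)\<in>H. a \<bullet> z \<le> t * (b + a \<bullet> y))"
        using inW[of t z] elim(1) mem_dilate_translate_iff[where t = t and z = z and H = H and y = y] by blast
      also have "\<dots> \<longleftrightarrow> z \<in> W \<and> z \<in> tight_or_strict \<sigma> H y t0"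
      proof -
        have "(\<forall>(a, b)\<in>H. a \<bullet> z \<le> t * (b + a \<bullet> y)) \<longleftrightarrow> (\<forall>(a, b)\<in>H. a \<bullet> z < t0 * (b + a \<bullet> y)
            \<or> a \<bullet> z = t0 * (b + a \<bullet> y) \<and> \<sigma> * (b + a \<bullet> y) > 0)" if "z \<in> W"
          using bspec[OF elim(2) that] by (intro ball_cong refl) blast
        then show ?thesis unfolding tight_or_strict_def by blast
      qed
      also have "\<dots> \<longleftrightarrow> z \<in> tight_or_strict \<sigma> H y t0"
      proof -
        have "z \<in> W" if "z \<in> tight_or_strict \<sigma> H y t0"
          using that t0 by (intro inW[of t0]) (auto simp: tight_or_strict_def)
        then show ?thesis by blast
      qed
      finally show "z \<in> (\<lambda>x. t *\<^sub>R x) ` translate ?P y \<inter> integer_lattice \<longleftrightarrow> z \<in> tight_or_strict \<sigma> H y t0" .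
    qed
    then show ?case by (simp add: lattice_count_def)
  qed
qed

text \<open>Positive rationals occur arbitrarily close to \<open>t0\<close> on either side, so
  counts at rational dilations already determine both one-sided limits at every real
  \<open>t0 > 0\<close>.\<close>

lemma card_tight_or_strict_eq:
  fixes H H' :: "((real ^ 'n::finite) \<times> real) set"
  assumes "finite H" "bounded {x. \<forall>(a, b)\<in>H. a \<bullet> x \<le> b}" "\<And>a b. (a, b) \<in> H \<Longrightarrow> b + a \<bullet> y \<noteq> 0"
    and "finite H'" "bounded {x. \<forall>(a, b)\<in>H'. a \<bullet> x \<le> b}" "\<And>a b. (a, b) \<in> H' \<Longrightarrow> b + a \<bullet> y \<noteq> 0"
    and eq: "\<And>t. t \<in> \<rat> \<Longrightarrow> t > 0 \<Longrightarrow> lattice_count (translate {x. \<forall>(a, b)\<in>H. a \<bullet> x \<le> b} y) t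
      = lattice_count (translate {x. \<forall>(a, b)\<in>H'. a \<bullet> x \<le> b} y) t"
    and t0: "t0 > 0" and \<sigma>: "\<sigma> \<noteq> 0"
  shows "card (tight_or_strict \<sigma> H y t0) = card (tight_or_strict \<sigma> H' y t0)"
proof -
  let ?P = "{x. \<forall>(a, b)\<in>H. a \<bullet> x \<le> b}" and ?Q = "{x. \<forall>(a, b)\<in>H'. a \<bullet> x \<le> b}"
  have "\<forall>\<^sub>F t in at t0 within {t. \<sigma> * (t - t0) > 0}.
      lattice_count (translate ?P y) t = card (tight_or_strict \<sigma> H y t0)
      \<and> lattice_count (translate ?Q y) t = card (tight_or_strict \<sigma> H' y t0)"
    by (intro eventually_conj eventually_lattice_count assms(1-6) t0 \<sigma>)
  then obtain d where d: "d > 0" "\<forall>t\<in>{t. \<sigma> * (t - t0) > 0}. t \<noteq> t0 \<and> dist t t0 < d \<longrightarrow>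
      lattice_count (translate ?P y) t = card (tight_or_strict \<sigma> H y t0)
      \<and> lattice_count (translate ?Q y) t = card (tight_or_strict \<sigma> H' y t0)"
    unfolding eventually_at by blast
  have "\<exists>t\<in>\<rat>. t > 0 \<and> \<sigma> * (t - t0) > 0 \<and> t \<noteq> t0 \<and> dist t t0 < d"
  proof (cases "\<sigma> > 0")
    case True
    obtain t where "t \<in> \<rat>" "t0 < t" "t < t0 + d"
      using Rats_dense_in_real[of t0 "t0 + d"] d(1) by auto
    then show ?thesis using True t0 by (intro bexI[of _ t]) (auto simp: dist_real_def)
  next
    case False
    \<comment> \<open>The maximum with 0 keeps the dilation positive when approaching from the
      left.\<close>
    obtain t where "t \<in> \<rat>" "max 0 (t0 - d) < t" "t < t0"
      using Rats_dense_in_real[of "max 0 (t0 - d)" t0] d(1) t0 by auto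
    then show ?thesis using False \<sigma>
      by (intro bexI[of _ t]) (auto simp: dist_real_def mult_neg_neg)
  qed
  then obtain t where t: "t \<in> \<rat>" "t > 0" "\<sigma> * (t - t0) > 0" "t \<noteq> t0" "dist t t0 < d" by blast
  have "lattice_count (translate ?P y) t = card (tight_or_strict \<sigma> H y t0)"
    "lattice_count (translate ?Q y) t = card (tight_or_strict \<sigma> H' y t0)"
    using d(2) t(3-5) by blast+
  then show ?thesis using eq[OF t(1,2)] by simp
qed

section \<open>Jumps of the count and recovery of the facets\<close>

lemma floor_multiple_tendsto: "(\<lambda>n. of_int \<lfloor>real n * x\<rfloor> / real n) \<longlonglongrightarrow> (x::real)"
proof (rule LIMSEQ_I)
  fix r :: real assume r: "r > 0"
  obtain N :: nat where N: "1 / r < N" using reals_Archimedean2 by blast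
  show "\<exists>no. \<forall>n\<ge>no. norm (of_int \<lfloor>real n * x\<rfloor> / real n - x) < r"
  proof (intro exI[of _ "Suc N"] allI impI)
    fix n assume n: "n \<ge> Suc N"
    then have "1 / r < n" using N by simp
    then have "1 < n * r" using r by (simp add: field_simps)
    moreover have "\<bar>of_int \<lfloor>real n * x\<rfloor> - real n * x\<bar> \<le> 1" by linarith
    moreover have "of_int \<lfloor>real n * x\<rfloor> / real n - x = (of_int \<lfloor>real n * x\<rfloor> - real n * x) / n"
      using n by (simp add: field_simps)
    ultimately show "norm (of_int \<lfloor>real n * x\<rfloor> / real n - x) < r"
      using n by (simp add: pos_divide_less_eq mult.commute)
  qed
qed

text \<open>Supplies a dilation at which the facet \<open>(a, b)\<close> contributes a jump: there a
  lattice point lies on the dilated translated facet and satisfies all other constraints.\<close>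

lemma lattice_point_on_dilated_facet:
  fixes H :: "((real ^ 'n::finite) \<times> real) set"
  assumes fin: "finite H" and ne: "b + a \<bullet> y \<noteq> 0" and x0: "a \<bullet> x0 = b"
    and strict: "\<And>a' b'. (a', b') \<in> H \<Longrightarrow> (a', b') \<noteq> (a, b) \<Longrightarrow> a' \<bullet> x0 < b'"
  obtains t z where "t > 0" "z \<in> integer_lattice" "a \<bullet> z = t * (b + a \<bullet> y)"
    "\<And>a' b'. (a', b') \<in> H \<Longrightarrow> a' \<bullet> z \<le> t * (b' + a' \<bullet> y)"
proof -
  define \<beta> where "\<beta> = b + a \<bullet> y"
  define w where "w = x0 + y"
  have aw: "a \<bullet> w = \<beta>" using x0 by (simp add: w_def \<beta>_def inner_simps)
  have \<beta>: "\<beta> \<noteq> 0" using ne by (simp add: \<beta>_def)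
  txt \<open>The lattice point is a multiple of a rational point near \<open>w\<close>: the cone over the relative
    interior of the translated facet is open because its hyperplane misses the origin.\<close>
  define q :: "nat \<Rightarrow> real ^ 'n" where "q n = (\<chi> i. of_int \<lfloor>real n * w $ i\<rfloor> / real n)" for n
  have q: "q \<longlonglongrightarrow> w"
    by (rule vec_tendstoI) (simp add: q_def floor_multiple_tendsto)
  \<comment> \<open>The ratio is the dilation factor that puts \<open>q n\<close> on the hyperplane
    of the translated facet; multiplied by \<open>n\<close> it becomes the required
    \<open>t\<close>. Its limit 1 makes it eventually positive and carries over the strict
    inequalities at \<open>x0\<close>.\<close>
  have s: "(\<lambda>n. (a \<bullet> q n) / \<beta>) \<longlonglongrightarrow> 1"
    using tendsto_divide[OF tendsto_inner[OF tendsto_const q] tendsto_const \<beta>, of a] aw \<beta> by simp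
  have "\<forall>\<^sub>F n in sequentially. (a \<bullet> q n) / \<beta> > 0"
    using order_tendstoD(1)[OF s, of 0] by simp
  moreover have "\<forall>\<^sub>F n in sequentially. \<forall>(a', b')\<in>H - {(a, b)}. a' \<bullet> q n < (a \<bullet> q n) / \<beta> * (b' + a' \<bullet> y)"
  proof -
    have "\<forall>\<^sub>F n in sequentially. a' \<bullet> q n < (a \<bullet> q n) / \<beta> * (b' + a' \<bullet> y)"
      if "(a', b') \<in> H - {(a, b)}" for a' b'
    proof -
      have "(\<lambda>n. (a \<bullet> q n) / \<beta> * (b' + a' \<bullet> y) - a' \<bullet> q n) \<longlonglongrightarrow> 1 * (b' + a' \<bullet> y) - a' \<bullet> w"
        by (intro tendsto_intros s q)
      moreover have "1 * (b' + a' \<bullet> y) - a' \<bullet> w > 0"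
        using strict[of a' b'] that by (simp add: w_def inner_simps)
      ultimately have "\<forall>\<^sub>F n in sequentially. (a \<bullet> q n) / \<beta> * (b' + a' \<bullet> y) - a' \<bullet> q n > 0"
        by (rule order_tendstoD(1))
      then show ?thesis by eventually_elim simp
    qed
    then show ?thesis using fin by (intro eventually_ball_finite) auto
  qed
  ultimately have "\<forall>\<^sub>F n in sequentially. n > 0 \<and> (a \<bullet> q n) / \<beta> > 0 \<and>
      (\<forall>(a', b')\<in>H - {(a, b)}. a' \<bullet> q n < (a \<bullet> q n) / \<beta> * (b' + a' \<bullet> y))"
    using eventually_gt_at_top[of "0::nat"] by eventually_elim auto
  then obtain n where n: "n > 0" "(a \<bullet> q n) / \<beta> > 0"
      "\<forall>(a', b')\<in>H - {(a, b)}. a' \<bullet> q n < (a \<bullet> q n) / \<beta> * (b' + a' \<bullet> y)"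
    using eventually_happens trivial_limit_sequentially by blast
  show ?thesis
  proof
    show "real n * ((a \<bullet> q n) / \<beta>) > 0" using n(1,2) by (intro mult_pos_pos) simp_all
    show "real n *\<^sub>R q n \<in> integer_lattice" using n(1) by (simp add: integer_lattice_def q_def)
    show eq: "a \<bullet> (real n *\<^sub>R q n) = real n * ((a \<bullet> q n) / \<beta>) * (b + a \<bullet> y)"
      using \<beta> by (simp add: \<beta>_def)
    show "a' \<bullet> (real n *\<^sub>R q n) \<le> real n * ((a \<bullet> q n) / \<beta>) * (b' + a' \<bullet> y)" if "(a', b') \<in> H" for a' b'
    proof (cases "(a', b') = (a, b)")
      case True
      then show ?thesis using eq by simp
    next
      case False
      then have "(a', b') \<in> H - {(a, b)}" using that by blast
      from bspec[OF n(3) this] have "a' \<bullet> q n \<le> (a \<bullet> q n) / \<beta> * (b' + a' \<bullet> y)" by simp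
      then have "real n * (a' \<bullet> q n) \<le> real n * ((a \<bullet> q n) / \<beta> * (b' + a' \<bullet> y))"
        by (intro mult_left_mono) auto
      then show ?thesis by (simp add: mult.assoc)
    qed
  qed
qed

lemma rat_independent_with_oneD:
  fixes a y :: "real ^ 'n::finite"
  assumes y: "rat_independent_with_one y" and rat: "b \<in> \<rat>" "\<And>i. a $ i \<in> \<rat>" and eq: "b + a \<bullet> y = 0"
  shows "b = 0" "a = 0"
proof -
  obtain c0 where c0: "b = of_rat c0" using rat(1) by (auto elim: Rats_cases)
  have "\<forall>i. \<exists>r. a $ i = of_rat r" using rat(2) by (auto elim: Rats_cases)
  then obtain c where c: "\<And>i. a $ i = of_rat (c i)" by metis
  have "of_rat c0 * 1 + (\<Sum>i\<in>UNIV. of_rat (c i) * y $ i) = 0"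
    using eq by (simp add: c0 c inner_vec_def)
  then have "c0 = 0" "\<forall>i. c i = 0" using y unfolding rat_independent_with_one_def by blast+
  then show "b = 0" "a = 0" by (auto simp: c0 c vec_eq_iff)
qed

text \<open>Both left-hand sides are rational, so eliminating the common \<open>t\<close> leaves a
  rational linear relation between 1 and the coordinates of \<open>y\<close>, whose coefficients
  must vanish. Separate points \<open>z\<close> and \<open>z'\<close> allow a comparison of
  constraints from two polytopes.\<close>

lemma tight_halfspaces_proportional:
  fixes a a' y z z' :: "real ^ 'n::finite"
  assumes y: "rat_independent_with_one y"
    and rat: "b \<in> \<rat>" "\<And>i. a $ i \<in> \<rat>" "b' \<in> \<rat>" "\<And>i. a' $ i \<in> \<rat>"
    and z: "z \<in> integer_lattice" "z' \<in> integer_lattice"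
    and tight: "a \<bullet> z = t * (b + a \<bullet> y)" "a' \<bullet> z' = t * (b' + a' \<bullet> y)"
    and t: "t \<noteq> 0" and ne: "b + a \<bullet> y \<noteq> 0"
  obtains k where "a' = k *\<^sub>R a" "b' = k * b"
proof -
  have dot: "c \<bullet> x \<in> \<rat>" if "\<And>i. c $ i \<in> \<rat>" "x \<in> integer_lattice" for c x :: "real ^ 'n"
    using that Ints_subset_Rats by (auto simp: inner_vec_def integer_lattice_def intro!: Rats_sum Rats_mult)
  define m m' where "m = a \<bullet> z" and "m' = a' \<bullet> z'"
  have m: "m \<in> \<rat>" "m' \<in> \<rat>" using dot rat z by (auto simp: m_def m'_def)
  have "(m * b' - m' * b) + (m *\<^sub>R a' - m' *\<^sub>R a) \<bullet> y = m * (b' + a' \<bullet> y) - m' * (b + a \<bullet> y)"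
    by (simp add: inner_simps algebra_simps)
  also have "\<dots> = 0" using tight by (simp add: m_def m'_def)
  finally have "m * b' - m' * b = 0" "m *\<^sub>R a' - m' *\<^sub>R a = 0"
    using rat m rat_independent_with_oneD[OF y, of "m * b' - m' * b" "m *\<^sub>R a' - m' *\<^sub>R a"]
    by simp_all
  moreover have "m \<noteq> 0" using t ne tight(1) by (simp add: m_def)
  moreover from this have "a' = (1 / m) *\<^sub>R (m *\<^sub>R a')" by simp
  ultimately have "a' = (m' / m) *\<^sub>R a" "b' = (m' / m) * b"
    by (simp, simp add: eq_divide_eq mult.commute)
  then show ?thesis by (rule that)
qed

text \<open>A jump caused by a facet of \<open>P\<close> must also occur for \<open>Q\<close>, and
  only a constraint of \<open>Q\<close> that is a positive multiple of this facet inequality can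
  cause it. So \<open>Q\<close> satisfies every facet inequality of \<open>P\<close>.\<close>

lemma subset_of_equal_counts:
  fixes y :: "real ^ 'n::finite"
  assumes y: "rat_independent_with_one y"
    and P: "P \<in> rational_polytopes" and Q: "Q \<in> rational_polytopes"
    and eq: "\<And>t. t \<in> \<rat> \<Longrightarrow> t > 0 \<Longrightarrow> lattice_count (translate P y) t = lattice_count (translate Q y) t"
  shows "Q \<subseteq> P"
proof -
  obtain H where H: "finite H" "P = {x. \<forall>(a, b)\<in>H. a \<bullet> x \<le> b}"
    "\<And>a b. (a, b) \<in> H \<Longrightarrow> a \<noteq> 0 \<and> (\<forall>i. a $ i \<in> \<rat>) \<and> b \<in> \<rat>"
    "\<And>a b. (a, b) \<in> H \<Longrightarrow> \<exists>x. a \<bullet> x = b \<and> (\<forall>(a', b')\<in>H - {(a, b)}. a' \<bullet> x < b')"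
    by (rule rational_polytope_halfspaces[OF P]) (rule that)
  obtain H' where H': "finite H'" "Q = {x. \<forall>(a, b)\<in>H'. a \<bullet> x \<le> b}"
    "\<And>a b. (a, b) \<in> H' \<Longrightarrow> a \<noteq> 0 \<and> (\<forall>i. a $ i \<in> \<rat>) \<and> b \<in> \<rat>"
    by (rule rational_polytope_halfspaces[OF Q]) (rule that)
  have bdd: "bounded R" if "R \<in> rational_polytopes" for R :: "(real ^ 'n) set"
    using that finite_imp_bounded_convex_hull by (auto simp: rational_polytopes_def)
  have ne: "b + a \<bullet> y \<noteq> 0" if "(a, b) \<in> H \<or> (a, b) \<in> H'" for a b
    using rat_independent_with_oneD(2)[OF y, of b a] H(3) H'(3) that by blast
  obtain p where p: "p \<in> interior P" using P by (auto simp: rational_polytopes_def)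
  have p_strict: "a \<bullet> p < b" if "(a, b) \<in> H" for a b
  proof -
    have "P \<subseteq> {x. a \<bullet> x \<le> b}" using that unfolding H(2) by blast
    then have "p \<in> interior {x. a \<bullet> x \<le> b}" using p interior_mono by blast
    then show ?thesis using interior_halfspace_le[of a b] H(3)[OF that] by blast
  qed
  have "a \<bullet> x \<le> b" if ab: "(a, b) \<in> H" and x: "x \<in> Q" for a b x
  proof -
    define \<beta> where "\<beta> = b + a \<bullet> y"
    have \<beta>: "\<beta> \<noteq> 0" using ne ab by (simp add: \<beta>_def)
    obtain x0 where x0: "a \<bullet> x0 = b" "\<forall>(a', b')\<in>H - {(a, b)}. a' \<bullet> x0 < b'" using H(4)[OF ab] by blast
    obtain t z where t: "t > 0" and z: "z \<in> integer_lattice" "a \<bullet> z = t * (b + a \<bullet> y)"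
      "\<And>a' b'. (a', b') \<in> H \<Longrightarrow> a' \<bullet> z \<le> t * (b' + a' \<bullet> y)"
    proof (rule lattice_point_on_dilated_facet[OF H(1) _ x0(1)])
      show "b + a \<bullet> y \<noteq> 0" using \<beta> by (simp add: \<beta>_def)
      show "a' \<bullet> x0 < b'" if "(a', b') \<in> H" "(a', b') \<noteq> (a, b)" for a' b'
        using x0(2) that by blast
    qed blast
    have multiple: "\<exists>k. a' = k *\<^sub>R a \<and> b' = k * b \<and> \<beta> * (b' + a' \<bullet> y) = k * \<beta>\<^sup>2"
      if a'b': "(a', b') \<in> H \<or> (a', b') \<in> H'" and z': "z' \<in> integer_lattice" "a' \<bullet> z' = t * (b' + a' \<bullet> y)"
      for a' b' z'
    proof -
      obtain k where "a' = k *\<^sub>R a" "b' = k * b"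
        using tight_halfspaces_proportional[OF y, of b a b' a' z z' t] H(3)[OF ab] H(3)[of a' b']
          H'(3)[of a' b'] a'b' z(1,2) z' t \<beta> unfolding \<beta>_def by (metis less_irrefl)
      then show ?thesis by (auto simp: \<beta>_def power2_eq_square algebra_simps)
    qed
    \<comment> \<open>Jumps cannot cancel within \<open>P\<close>: a tight constraint with the
      opposite sign would be a nonpositive multiple of \<open>(a, b)\<close>, contradicting that the
      interior point \<open>p\<close> satisfies both strictly.\<close>
    have positive: "\<beta> * (b' + a' \<bullet> y) > 0"
      if a'b': "(a', b') \<in> H" and z': "z' \<in> integer_lattice" "a' \<bullet> z' = t * (b' + a' \<bullet> y)" for a' b' z'
    proof (rule ccontr)
      assume "\<not> \<beta> * (b' + a' \<bullet> y) > 0"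
      moreover obtain k where k: "a' = k *\<^sub>R a" "b' = k * b" "\<beta> * (b' + a' \<bullet> y) = k * \<beta>\<^sup>2"
        using multiple a'b' z' by blast
      ultimately have "k * \<beta>\<^sup>2 \<le> 0" by linarith
      then have "k \<le> 0" using \<beta> by (simp add: mult_le_0_iff)
      then have "k * b \<le> k * (a \<bullet> p)" using p_strict[OF ab] by (intro mult_left_mono_neg) auto
      then show False using p_strict[OF a'b'] k by simp
    qed
    have fin: "finite (tight_or_strict \<sigma> H y t)" "finite (tight_or_strict \<sigma> H' y t)" for \<sigma>
      using bdd[OF P] bdd[OF Q] finite_tight_or_strict t unfolding H(2) H'(2) by blast+
    \<comment> \<open>By \<open>positive\<close>, the side of \<open>- \<beta>\<close> keeps only
      points strict in all constraints, while the side of \<beta> also keeps tight ones, among them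
      \<open>z\<close>.\<close>
    have "tight_or_strict (- \<beta>) H y t \<subset> tight_or_strict \<beta> H y t"
    proof
      show "tight_or_strict (- \<beta>) H y t \<subseteq> tight_or_strict \<beta> H y t"
        using positive by (fastforce simp: tight_or_strict_def)
      have "z \<in> tight_or_strict \<beta> H y t"
        using z positive by (fastforce simp: tight_or_strict_def)
      moreover have "z \<notin> tight_or_strict (- \<beta>) H y t"
      proof
        assume "z \<in> tight_or_strict (- \<beta>) H y t"
        then have "a \<bullet> z < t * (b + a \<bullet> y) \<or> - \<beta> * (b + a \<bullet> y) > 0"
          using ab unfolding tight_or_strict_def by blast
        then show False using z(2) positive[OF ab z(1,2)] by simp
      qed
      ultimately show "tight_or_strict (- \<beta>) H y t \<noteq> tight_or_strict \<beta> H y t" by blast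
    qed
    then have "card (tight_or_strict (- \<beta>) H y t) < card (tight_or_strict \<beta> H y t)"
      using fin by (intro psubset_card_mono)
    moreover have "card (tight_or_strict \<sigma> H y t) = card (tight_or_strict \<sigma> H' y t)" if "\<sigma> \<noteq> 0" for \<sigma>
      using bdd[OF P] bdd[OF Q] eq ne unfolding H(2) H'(2)
      by (intro card_tight_or_strict_eq H(1) H'(1) t that) blast+
    ultimately have "card (tight_or_strict (- \<beta>) H' y t) < card (tight_or_strict \<beta> H' y t)"
      using \<beta> by simp
    \<comment> \<open>A point gained by \<open>Q\<close> on the side of \<beta> must have a tight
      constraint whose right-hand side changes with the sign of \<beta>; this sign forces
      \<open>k > 0\<close> below.\<close>
    then have "\<not> tight_or_strict \<beta> H' y t \<subseteq> tight_or_strict (- \<beta>) H' y t"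
      using card_mono[OF fin(2)] by (meson leD)
    then obtain z' where z': "z' \<in> tight_or_strict \<beta> H' y t" "z' \<notin> tight_or_strict (- \<beta>) H' y t" by blast
    then obtain a' b' where a'b': "(a', b') \<in> H'" "a' \<bullet> z' = t * (b' + a' \<bullet> y)" "\<beta> * (b' + a' \<bullet> y) > 0"
      unfolding tight_or_strict_def by blast
    have "z' \<in> integer_lattice" using z' by (simp add: tight_or_strict_def)
    then obtain k where k: "a' = k *\<^sub>R a" "b' = k * b" "\<beta> * (b' + a' \<bullet> y) = k * \<beta>\<^sup>2"
      using multiple a'b' by blast
    have "k > 0" using a'b'(3) unfolding k(3) by (simp add: zero_less_mult_iff)
    moreover have "a' \<bullet> x \<le> b'" using x a'b'(1) unfolding H'(2) by blast
    ultimately show ?thesis using k by simp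
  qed
  then show ?thesis unfolding H(2) by blast
qed

section \<open>Distinct polytopes with equal counts in the dependent case\<close>

lemma rational_polytopes_linear_image:
  fixes f :: "real ^ 'n::finite \<Rightarrow> real ^ 'n"
  assumes P: "P \<in> rational_polytopes" and f: "linear f" "inj f"
    and rat: "\<And>x. \<forall>i. x $ i \<in> \<rat> \<Longrightarrow> \<forall>i. f x $ i \<in> \<rat>"
  shows "f ` P \<in> rational_polytopes"
proof -
  obtain V where V: "finite V" "\<And>v. v \<in> V \<Longrightarrow> \<forall>i. v $ i \<in> \<rat>" "P = convex hull V"
    and int: "interior P \<noteq> {}"
    using P unfolding rational_polytopes_def by blast
  have "finite (f ` V) \<and> (\<forall>v\<in>f ` V. \<forall>i. v $ i \<in> \<rat>) \<and> f ` P = convex hull (f ` V)"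
    using V rat convex_hull_linear_image[OF f(1)] by auto
  moreover have "interior (f ` P) \<noteq> {}"
    using int by (simp add: interior_injective_linear_image[OF f])
  ultimately show ?thesis unfolding rational_polytopes_def by blast
qed

lemma rational_polytopes_translate:
  fixes P :: "(real ^ 'n::finite) set"
  assumes P: "P \<in> rational_polytopes" and w: "\<And>i. w $ i \<in> \<rat>"
  shows "translate P w \<in> rational_polytopes"
proof -
  obtain V where V: "finite V" "\<And>v. v \<in> V \<Longrightarrow> \<forall>i. v $ i \<in> \<rat>" "P = convex hull V"
    and int: "interior P \<noteq> {}"
    using P unfolding rational_polytopes_def by blast
  have eq: "translate X w = (+) w ` X" for X by (auto simp: add.commute)
  have "finite (translate V w) \<and> (\<forall>v\<in>translate V w. \<forall>i. v $ i \<in> \<rat>)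
      \<and> translate P w = convex hull (translate V w)"
    using V w by (auto simp: eq convex_hull_translation intro: Rats_add)
  moreover have "interior (translate P w) \<noteq> {}"
    using int by (simp add: eq interior_translation)
  ultimately show ?thesis unfolding rational_polytopes_def by blast
qed

lemma unit_cube_rational_polytope: "cbox (0 :: real ^ 'n::finite) 1 \<in> rational_polytopes"
proof -
  have "finite {x :: real ^ 'n. \<forall>i. x $ i = 0 \<or> x $ i = 1}"
  proof -
    have "finite {f. \<forall>i::'n. f i \<in> {0, 1::real}}"
      using finite_PiE[of "UNIV :: 'n set" "\<lambda>_. {0, 1::real}"] by (simp add: PiE_def Pi_def)
    then have "finite (vec_lambda ` {f. \<forall>i::'n. f i \<in> {0, 1::real}})" by simp
    moreover have "{x :: real ^ 'n. \<forall>i. x $ i = 0 \<or> x $ i = 1} \<subseteq> vec_lambda ` {f. \<forall>i. f i \<in> {0, 1}}"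
    proof
      fix x :: "real ^ 'n" assume "x \<in> {x. \<forall>i. x $ i = 0 \<or> x $ i = 1}"
      then show "x \<in> vec_lambda ` {f. \<forall>i. f i \<in> {0, 1}}"
        by (intro image_eqI[of _ _ "vec_nth x"]) auto
    qed
    ultimately show ?thesis by (rule finite_subset[rotated])
  qed
  moreover have "interior (cbox (0 :: real ^ 'n) 1) \<noteq> {}"
    by (simp add: interior_cbox box_ne_empty Basis_vec_def inner_axis)
  moreover have "\<forall>v\<in>{x :: real ^ 'n. \<forall>i. x $ i = 0 \<or> x $ i = 1}. \<forall>i. v $ i \<in> \<rat>"
    by (metis (mono_tags, lifting) Rats_0 Rats_1 mem_Collect_eq)
  moreover have "cbox (0 :: real ^ 'n) 1 = convex hull {x. \<forall>i. x $ i = 0 \<or> x $ i = 1}"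
    using unit_interval_convex_hull[where 'a = "real ^ 'n"]
    unfolding Cart_1 by (simp add: Basis_vec_def inner_axis)
  ultimately show ?thesis unfolding rational_polytopes_def by blast
qed

lemma common_denominator:
  assumes "finite A" "A \<subseteq> \<rat>"
  obtains N :: real where "N \<in> \<int>" "N > 0" "\<And>x. x \<in> A \<Longrightarrow> N * x \<in> \<int>"
proof -
  have "\<exists>N::real. N \<in> \<int> \<and> N > 0 \<and> (\<forall>x\<in>A. N * x \<in> \<int>)"
    using assms
  proof induction
    case empty
    show ?case by (intro exI[of _ 1]) auto
  next
    case (insert x A)
    then obtain N :: real where N: "N \<in> \<int>" "N > 0" "\<forall>x\<in>A. N * x \<in> \<int>" by auto
    from insert obtain p q where pq: "q > 0" "x = of_int p / of_int q"
      by (metis Rats_cases' insert_subset)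
    have "N * of_int q * x \<in> \<int>" using N pq by simp
    moreover have "N * of_int q * y \<in> \<int>" if "y \<in> A" for y
      using N that by (metis Ints_mult Ints_of_int mult.assoc mult.commute)
    ultimately show ?case using N pq by (intro exI[of _ "N * of_int q"]) auto
  qed
  then show ?thesis using that by blast
qed

text \<open>The map commutes with dilations and permutes the lattice, so it matches the lattice
  points of the two dilates.\<close>

lemma lattice_count_invariant:
  fixes f :: "real ^ 'n::finite \<Rightarrow> real ^ 'n"
  assumes f: "linear f" "bij f" and lat: "f ` integer_lattice = integer_lattice"
  shows "lattice_count (f ` K) t = lattice_count K t"
proof -
  have "(\<lambda>x. t *\<^sub>R x) ` f ` K = f ` (\<lambda>x. t *\<^sub>R x) ` K"
    by (simp add: image_image linear_cmul[OF f(1)])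
  then have "(\<lambda>x. t *\<^sub>R x) ` f ` K \<inter> integer_lattice = f ` ((\<lambda>x. t *\<^sub>R x) ` K \<inter> integer_lattice)"
    using lat by (metis bij_is_inj[OF f(2)] image_Int)
  then show ?thesis
    unfolding lattice_count_def
    by (metis card_image bij_is_inj[OF f(2)] inj_on_subset subset_UNIV)
qed

text \<open>The map \<open>f\<close> has determinant \<open>1 + a \<bullet> v\<close>, so the
  condition on its square makes \<open>f\<close> unimodular. It fixes the hyperplane orthogonal to
  \<open>a\<close> pointwise, and a rational shift \<open>w\<close> moves \<open>y\<close> into that
  hyperplane.\<close>

lemma equal_counts_of_dependent:
  fixes y :: "real ^ 'n::finite"
  assumes "\<not> rat_independent_with_one y"
  obtains P Q where "P \<in> rational_polytopes" "Q \<in> rational_polytopes" "P \<noteq> Q"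
    "\<And>t. lattice_count (translate P y) t = lattice_count (translate Q y) t"
proof -
  obtain c0 :: rat and c :: "'n \<Rightarrow> rat"
    where dep: "of_rat c0 + (\<Sum>i\<in>UNIV. of_rat (c i) * y $ i) = 0" and ne: "c0 \<noteq> 0 \<or> (\<exists>i. c i \<noteq> 0)"
    using assms unfolding rat_independent_with_one_def by auto
  have "\<exists>i. c i \<noteq> 0"
  proof (rule ccontr)
    assume "\<not> ?thesis"
    then show False using dep ne by simp
  qed
  then obtain i where ci: "c i \<noteq> 0" by blast
  obtain N :: real where N: "N \<in> \<int>" "N > 0" "\<And>x. x \<in> range (\<lambda>j. of_rat (c j)) \<Longrightarrow> N * x \<in> \<int>"
    by (rule common_denominator[of "range (\<lambda>j. of_rat (c j))"]) auto
  define a :: "real ^ 'n" where "a = (\<chi> j. N * of_rat (c j))"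
  have a_int: "a $ j \<in> \<int>" for j unfolding a_def using N(3) by simp
  have ai: "a $ i \<noteq> 0" using ci N(2) by (simp add: a_def)
  have "a \<bullet> y = N * (\<Sum>j\<in>UNIV. of_rat (c j) * y $ j)"
    by (simp add: a_def inner_vec_def sum_distrib_left mult_ac)
  also have "\<dots> = - (N * of_rat c0)" using dep by (simp add: add_eq_0_iff2)
  finally have ay: "a \<bullet> y \<in> \<rat>" using N(1) Ints_subset_Rats by auto
  \<comment> \<open>The square covers two cases: a shear with product 0 in dimension at least 2, and
    in dimension 1, where no nonzero \<open>v\<close> is orthogonal to \<open>a'\<close>, the
    reflection with product -2.\<close>
  have "\<exists>a' v :: real ^ 'n. (\<forall>j. a' $ j \<in> \<int>) \<and> (\<forall>j. v $ j \<in> \<int>) \<and> a' \<noteq> 0 \<and> v \<noteq> 0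
      \<and> a' \<bullet> y \<in> \<rat> \<and> (1 + a' \<bullet> v)\<^sup>2 = 1"
  proof (cases "\<exists>j. j \<noteq> i")
    case True
    then obtain j where j: "j \<noteq> i" by blast
    define v where "v = a $ j *\<^sub>R axis i 1 - a $ i *\<^sub>R axis j (1::real)"
    have "v $ j \<noteq> 0" using j ai by (simp add: v_def axis_def)
    then have "v \<noteq> 0" by auto
    moreover have "v $ k \<in> \<int>" for k using a_int by (auto simp: v_def axis_def)
    moreover have "a \<bullet> v = 0" by (simp add: v_def inner_diff_right inner_axis)
    ultimately show ?thesis using a_int ai ay by (intro exI[of _ a] exI[of _ v]) auto
  next
    case False
    then have U: "(UNIV :: 'n set) = {i}" by auto
    let ?e = "axis i 1 :: real ^ 'n"
    have "y $ i = (a \<bullet> y) / a $ i" using ai by (simp add: inner_vec_def U)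
    then have "y $ i \<in> \<rat>" using ay a_int[of i] Ints_subset_Rats by auto
    moreover have "?e \<noteq> 0" by (simp add: axis_eq_0_iff)
    ultimately show ?thesis
      by (intro exI[of _ ?e] exI[of _ "- 2 *\<^sub>R ?e"]) (auto simp: inner_axis inner_axis', auto simp: axis_def)
  qed
  then obtain a v :: "real ^ 'n" where a: "\<And>j. a $ j \<in> \<int>" "a \<noteq> 0" "a \<bullet> y \<in> \<rat>"
    and v: "\<And>j. v $ j \<in> \<int>" "v \<noteq> 0" and av: "(1 + a \<bullet> v)\<^sup>2 = 1"
    by blast
  define f where "f x = x + (a \<bullet> x) *\<^sub>R v" for x
  \<comment> \<open>Applying \<open>f\<close> multiplies \<open>a \<bullet> x\<close> by
    \<open>1 + a \<bullet> v\<close>, which is its own inverse; this gives the inverse of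
    \<open>f\<close> with integer coefficients.\<close>
  define g where "g x = x - ((1 + a \<bullet> v) * (a \<bullet> x)) *\<^sub>R v" for x
  have av': "(1 + a \<bullet> v) * (1 + a \<bullet> v) = 1" using av by (simp add: power2_eq_square)
  have gf: "g (f x) = x" for x
  proof -
    have "(1 + a \<bullet> v) * (a \<bullet> f x) = ((1 + a \<bullet> v) * (1 + a \<bullet> v)) * (a \<bullet> x)"
      by (simp add: f_def inner_simps algebra_simps)
    then show ?thesis using av' by (simp add: f_def g_def)
  qed
  have fg: "f (g x) = x" for x
  proof -
    have "a \<bullet> g x = (1 - (1 + a \<bullet> v) * (a \<bullet> v)) * (a \<bullet> x)"
      by (simp add: g_def inner_simps algebra_simps)
    also have "1 - (1 + a \<bullet> v) * (a \<bullet> v) = 1 + a \<bullet> v" using av' by (simp add: algebra_simps)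
    finally show ?thesis by (simp add: f_def g_def)
  qed
  have lin: "linear f"
    by (rule linearI) (auto simp: f_def inner_simps algebra_simps)
  have bij: "bij f" using gf fg by (metis bijI')
  have dot_int: "a \<bullet> x \<in> \<int>" if "\<And>j. x $ j \<in> \<int>" for x
    using that a by (auto simp: inner_vec_def intro!: Ints_sum)
  have "f x \<in> integer_lattice" "g x \<in> integer_lattice" if "x \<in> integer_lattice" for x
    using that v(1) dot_int[of x] dot_int[of v] by (auto simp: integer_lattice_def f_def g_def)
  then have lat: "f ` integer_lattice = integer_lattice"
    using fg by (auto simp: image_iff) metis
  define w where "w = ((a \<bullet> y) / (a \<bullet> a)) *\<^sub>R a"
  have "a \<bullet> a \<in> \<rat>" using dot_int[of a] a Ints_subset_Rats by auto
  then have w: "w $ j \<in> \<rat>" for j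
    using a Ints_subset_Rats by (auto simp: w_def intro!: Rats_divide Rats_mult)
  have "a \<bullet> (y - w) = 0" using a(2) by (simp add: w_def inner_simps)
  then have fy: "f (y - w) = y - w" by (simp add: f_def)
  obtain k where k: "v $ k \<noteq> 0" using v(2) by (auto simp: vec_eq_iff)
  \<comment> \<open>Far enough out along \<open>a\<close>, \<open>f\<close> displaces the corner
    \<open>p\<close> by at least 2 in coordinate \<open>k\<close>, more than the width of the
    cube.\<close>
  define p where "p = 2 *\<^sub>R a"
  define P where "P = translate (cbox 0 1) p"
  have P: "P \<in> rational_polytopes"
    unfolding P_def using a(1) Ints_subset_Rats
    by (intro rational_polytopes_translate unit_cube_rational_polytope) (auto simp: p_def)
  have fP: "f ` P \<in> rational_polytopes"
  proof (rule rational_polytopes_linear_image[OF P lin bij_is_inj[OF bij]])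
    fix x :: "real ^ 'n" assume x: "\<forall>i. x $ i \<in> \<rat>"
    then have "a \<bullet> x \<in> \<rat>"
      using a(1) Ints_subset_Rats by (auto simp: inner_vec_def intro!: Rats_sum Rats_mult)
    then show "\<forall>i. f x $ i \<in> \<rat>"
      using x v(1) Ints_subset_Rats by (auto simp: f_def intro!: Rats_add Rats_mult)
  qed
  have neq: "f ` P \<noteq> P"
  proof
    assume eq: "f ` P = P"
    have "p \<in> P" unfolding P_def by (auto simp: mem_box_cart intro!: image_eqI[of _ _ 0])
    then have "f p \<in> P" using eq by blast
    then have fpk: "\<bar>f p $ k - p $ k\<bar> \<le> 1" by (auto simp: P_def mem_box_cart)
    have one: "\<bar>v $ k\<bar> \<ge> 1" using v(1) k by (metis Ints_nonzero_abs_ge1)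
    have "a \<bullet> a \<ge> 1"
      using Ints_nonzero_abs_ge1[OF dot_int[OF a(1)]] a(2) by simp
    then have "1 * 1 \<le> (a \<bullet> a) * \<bar>v $ k\<bar>" using one by (intro mult_mono) auto
    moreover have "\<bar>f p $ k - p $ k\<bar> = 2 * ((a \<bullet> a) * \<bar>v $ k\<bar>)"
      by (simp add: f_def p_def abs_mult)
    ultimately show False using fpk by linarith
  qed
  have tr: "translate (translate X (- w)) y = translate X (y - w)" for X
    by (simp add: image_image algebra_simps)
  \<comment> \<open>Since \<open>f\<close> fixes \<open>y - w\<close>, translating the image is the
    same as mapping the translate, and lattice invariance then equates the counts.\<close>
  have feq: "translate (f ` P) (y - w) = f ` translate P (y - w)"
    by (simp add: image_image linear_add[OF lin] fy)
  show ?thesis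
  proof
    show "translate P (- w) \<in> rational_polytopes" "translate (f ` P) (- w) \<in> rational_polytopes"
      using w by (intro rational_polytopes_translate P fP; simp)+
    show "translate P (- w) \<noteq> translate (f ` P) (- w)"
    proof
      assume "translate P (- w) = translate (f ` P) (- w)"
      moreover have "inj (\<lambda>x. x + - w)" by (simp add: inj_def)
      ultimately show False using neq by (metis inj_image_eq_iff)
    qed
    show "lattice_count (translate (translate P (- w)) y) t
        = lattice_count (translate (translate (f ` P) (- w)) y) t" for t
      unfolding tr feq lattice_count_invariant[OF lin bij lat] ..
  qed
qed

theorem theorem1:
  shows "(U_rational :: (real ^ 'n::finite) set) = U_real \<and> (U_real :: (real ^ 'n) set) = A_set
    \<and> (\<forall>y :: real ^ 'n. rat_independent_with_one y \<longrightarrow>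
         (\<forall>P\<in>rational_polytopes. \<forall>Q\<in>rational_polytopes.
            (\<forall>t\<in>\<rat>. t > 0 \<longrightarrow> lattice_count (translate P y) t = lattice_count (translate Q y) t)
            \<longrightarrow> P = Q))
    \<and> (\<forall>y :: real ^ 'n. \<not> rat_independent_with_one y \<longrightarrow>
         (\<exists>P\<in>rational_polytopes. \<exists>Q\<in>rational_polytopes. P \<noteq> Q \<and>
            (\<forall>t>0. lattice_count (translate P y) t = lattice_count (translate Q y) t)))"
proof -
  have indep: "P = Q" if "rat_independent_with_one y" "P \<in> rational_polytopes" "Q \<in> rational_polytopes"
    "\<forall>t\<in>\<rat>. t > 0 \<longrightarrow> lattice_count (translate P y) t = lattice_count (translate Q y) t"
    for y :: "real ^ 'n" and P Q
    using subset_of_equal_counts[of y P Q] subset_of_equal_counts[of y Q P] that by force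
  have dep: "\<exists>P\<in>rational_polytopes. \<exists>Q\<in>rational_polytopes. P \<noteq> Q \<and>
      (\<forall>t>0. lattice_count (translate P y) t = lattice_count (translate Q y) t)"
    if "\<not> rat_independent_with_one y" for y :: "real ^ 'n"
    using equal_counts_of_dependent[OF that] by metis
  \<comment> \<open>The three sets are compared in a cycle; the middle inclusion holds because
    agreement at all real dilations includes agreement at rational ones.\<close>
  have "(A_set :: (real ^ 'n) set) \<subseteq> U_rational"
    unfolding A_set_def U_rational_def using indep by blast
  moreover have "(U_rational :: (real ^ 'n) set) \<subseteq> U_real"
    unfolding U_rational_def U_real_def by blast
  moreover have "(U_real :: (real ^ 'n) set) \<subseteq> A_set"
    unfolding A_set_def U_real_def using dep by blast
  ultimately show ?thesis using indep dep by blast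
qed

end
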